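(* Let $m,n$ be integers with $2\le n\le m-2$. The normal radius of the cone over the Plücker embedding $i(\widetilde G(n,m;\mathbb{R}))\subset\wedge^n\mathbb{R}^m$ is at least $\frac{\pi}{2}$.
   Context: $\widetilde G(n,m;\mathbb{R})$ is the Grassmannian of oriented $n$-dimensional subspaces of $\mathbb{R}^m$. The space $\wedge^n\mathbb{R}^m$ carries the induced Euclidean inner product $\langle u_1\wedge\cdots\wedge u_n,v_1\wedge\cdots\wedge v_n\rangle=\det(\langle u_i,v_j\rangle)$. The Plücker embedding $i$ sends an oriented $n$-plane with oriented orthonormal basis $u_1,\dots,u_n$ to $u_1\wedge\cdots\wedge u_n$; its image lies in the unit sphere. The cone over a subset $M$ of a sphere about $0$ is $\{tx:x\in M,\ t\ge0\}$. Normal radius: let $M$ be a compact submanifold of a sphere about $0$ of radius $R$ in a Euclidean space, and $C$ its cone. The normal radius of $C$ is the smallest $\theta\in(0,\pi]$ for which there exist $p\in M$ and a vector $\xi$ of length $R$ normal to $C$ at $p$ (i.e. orthogonal to $p$ and to $T_pM$) with $\cos(\theta)\,p+\sin(\theta)\,\xi\in M$. *)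

theory Defs
  imports "HOL-Analysis.Analysis"
begin

section \<open>The exterior power as a Euclidean space\<close>

text \<open>
  An \<open>n\<close>-tuple of vectors of \<open>\<real>\<^sup>m\<close> is a matrix \<open>U :: real^'m^'n\<close> whose rows \<open>U $ i\<close> are
  the vectors of the tuple; \<open>n = CARD('n)\<close> and \<open>m = CARD('m)\<close>.

  The space \<open>\<real>^('n \<Rightarrow> 'm)\<close> is the \<open>n\<close>-fold tensor power of \<open>\<real>\<^sup>m\<close>, and the wedge product is
  the antisymmetrised tensor product.  The factor \<open>1 / sqrt (n!)\<close> makes the standard inner
  product of the tensor power restrict to the induced inner product of the exterior power;
  see \<open>inner_wedge\<close>.
\<close>

definition wedge :: "real^'m^'n \<Rightarrow> real^('n \<Rightarrow> 'm)" where
  "wedge U = (\<chi> I. det (\<chi> i j. U $ i $ I j) / sqrt (fact CARD('n)))"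

definition exterior_power :: "(real^('n::finite \<Rightarrow> 'm::finite)) set" where
  "exterior_power = span (range wedge)"

lemma inner_wedge:
  fixes U V :: "real^'m^'n"
  shows "wedge U \<bullet> wedge V = det (\<chi> i j. U $ i \<bullet> V $ j)"
proof -
  let ?P = "{p. p permutes (UNIV :: 'n set)}"
  let ?s = "\<lambda>p. of_int (sign p) :: real"
  let ?G = "\<chi> i j. U $ i \<bullet> V $ j"
  have leib: "det (\<chi> i j. W $ i $ I j) = (\<Sum>p\<in>?P. ?s p * (\<Prod>j\<in>UNIV. W $ p j $ I j))"
    for W :: "real^'m^'n" and I
  proof -
    have "det (\<chi> i j. W $ i $ I j) = det (transpose (\<chi> i j. W $ i $ I j))"
      by (simp add: det_transpose)
    also have "\<dots> = (\<Sum>p\<in>?P. ?s p * (\<Prod>j\<in>UNIV. W $ p j $ I j))"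
      unfolding det_def by (simp add: transpose_def)
    finally show ?thesis .
  qed
  have dist: "(\<Sum>I\<in>UNIV. (\<Prod>j\<in>UNIV. U $ p j $ I j) * (\<Prod>j\<in>UNIV. V $ q j $ I j))
      = (\<Prod>j\<in>UNIV. U $ p j \<bullet> V $ q j)" for p q :: "'n \<Rightarrow> 'n"
  proof -
    have "(\<Prod>j\<in>UNIV. \<Sum>k\<in>UNIV. U $ p j $ k * V $ q j $ k)
        = (\<Sum>I\<in>Pi\<^sub>E UNIV (\<lambda>_. UNIV). \<Prod>j\<in>UNIV. U $ p j $ I j * V $ q j $ I j)"
      by (rule prod_sum_PiE) auto
    then show ?thesis
      by (simp add: inner_vec_def prod.distrib PiE_UNIV_domain)
  qed
  have col: "(\<Sum>q\<in>?P. ?s p * ?s q * (\<Prod>j\<in>UNIV. U $ p j \<bullet> V $ q j)) = det ?G"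
    if p: "p \<in> ?P" for p
  proof -
    have "(\<Sum>q\<in>?P. ?s p * ?s q * (\<Prod>j\<in>UNIV. U $ p j \<bullet> V $ q j)) =
        ?s p * (\<Sum>q\<in>?P. ?s q * (\<Prod>j\<in>UNIV. (\<chi> i. ?G $ p i) $ j $ q j))"
      by (simp add: sum_distrib_left mult.assoc)
    also have "\<dots> = ?s p * det (\<chi> i. ?G $ p i)"
      by (simp add: det_def)
    also have "\<dots> = ?s p * (?s p * det ?G)"
      using det_permute_rows[of p ?G] p by simp
    also have "\<dots> = det ?G"
      by (simp add: sign_def)
    finally show ?thesis .
  qed
  have "(\<Sum>I\<in>UNIV. det (\<chi> i j. U $ i $ I j) * det (\<chi> i j. V $ i $ I j))
      = (\<Sum>I\<in>UNIV. \<Sum>p\<in>?P. \<Sum>q\<in>?P. ?s p * ?s q *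
          ((\<Prod>j\<in>UNIV. U $ p j $ I j) * (\<Prod>j\<in>UNIV. V $ q j $ I j)))"
    unfolding leib sum_product by (simp add: mult_ac)
  also have "\<dots> = (\<Sum>p\<in>?P. \<Sum>I\<in>UNIV. \<Sum>q\<in>?P. ?s p * ?s q *
          ((\<Prod>j\<in>UNIV. U $ p j $ I j) * (\<Prod>j\<in>UNIV. V $ q j $ I j)))"
    by (rule sum.swap)
  also have "\<dots> = (\<Sum>p\<in>?P. \<Sum>q\<in>?P. \<Sum>I\<in>UNIV. ?s p * ?s q *
          ((\<Prod>j\<in>UNIV. U $ p j $ I j) * (\<Prod>j\<in>UNIV. V $ q j $ I j)))"
    by (intro sum.cong refl sum.swap)
  also have "\<dots> = (\<Sum>p\<in>?P. \<Sum>q\<in>?P. ?s p * ?s q * (\<Prod>j\<in>UNIV. U $ p j \<bullet> V $ q j))"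
    by (simp add: sum_distrib_left[symmetric] dist)
  also have "\<dots> = (\<Sum>p\<in>?P. det ?G)"
    by (intro sum.cong refl col)
  also have "\<dots> = fact CARD('n) * det ?G"
    by (simp add: card_permutations)
  finally show ?thesis
    by (simp add: wedge_def inner_vec_def sum_divide_distrib[symmetric])
qed

lemma wedge_matrix_mult:
  fixes U :: "real^'m^'n" and A :: "real^'n^'n"
  shows "wedge (A ** U) = det A *\<^sub>R wedge U"
proof -
  have "(\<chi> i j. (A ** U) $ i $ I j) = A ** (\<chi> i j. U $ i $ I j)" for I :: "'n \<Rightarrow> 'm"
    by (simp add: matrix_matrix_mult_def vec_eq_iff)
  then show ?thesis
    by (simp add: wedge_def vec_eq_iff det_mul)
qed


section \<open>Oriented planes and the Pluecker embedding\<close>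

definition ordered_bases :: "(real^'m^'n) set" where
  "ordered_bases = {U. inj (\<lambda>i. U $ i) \<and> independent (range (\<lambda>i. U $ i))}"

text \<open>
  Two ordered bases span the same plane with the same orientation iff the change-of-basis
  matrix \<open>A\<close>, given by \<open>V $ i = (\<Sum>j. A $ i $ j *\<^sub>R U $ j)\<close>, has positive determinant.
  An oriented plane is the class of its positively oriented ordered bases.
\<close>

definition co_oriented :: "((real^'m^'n) \<times> (real^'m^'n)) set" where
  "co_oriented = {(U, V). U \<in> ordered_bases \<and> V \<in> ordered_bases \<and>
     (\<exists>A :: real^'n^'n. det A > 0 \<and> V = A ** U)}"

definition oriented_grassmannian :: "(real^'m^'n) set set" where
  "oriented_grassmannian = ordered_bases // co_oriented"

definition orthonormal_tuple :: "real^'m^'n \<Rightarrow> bool" where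
  "orthonormal_tuple U \<longleftrightarrow> (\<forall>i j. U $ i \<bullet> U $ j = (if i = j then 1 else 0))"

definition plucker :: "(real^'m^'n) set \<Rightarrow> real^('n \<Rightarrow> 'm)" where
  "plucker P = wedge (SOME U. U \<in> P \<and> orthonormal_tuple U)"

lemma equiv_co_oriented: "equiv ordered_bases (co_oriented :: ((real^'m^'n) \<times> _) set)"
proof (rule equivI)
  show "co_oriented \<subseteq> ordered_bases \<times> (ordered_bases :: (real^'m^'n) set)"
    by (auto simp: co_oriented_def)
  show "refl_on ordered_bases (co_oriented :: ((real^'m^'n) \<times> _) set)"
    unfolding refl_on_def co_oriented_def
    by (auto intro!: exI[of _ "mat 1"])
  show "sym (co_oriented :: ((real^'m^'n) \<times> _) set)"
  proof (rule symI)
    fix U V :: "real^'m^'n"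
    assume "(U, V) \<in> co_oriented"
    then obtain A :: "real^'n^'n" where UV: "U \<in> ordered_bases" "V \<in> ordered_bases"
      and A: "det A > 0" "V = A ** U"
      by (auto simp: co_oriented_def)
    then obtain B where B: "A ** B = mat 1" "B ** A = mat 1"
      using invertible_det_nz[of A] by (auto simp: invertible_def)
    then have "det B * det A = 1"
      by (metis det_I det_mul)
    then have "det B > 0"
      using A(1) by (metis zero_less_mult_pos2 zero_less_one)
    moreover have "U = B ** V"
      using A B by (simp add: matrix_mul_assoc)
    ultimately show "(V, U) \<in> co_oriented"
      using UV by (auto simp: co_oriented_def)
  qed
  show "trans (co_oriented :: ((real^'m^'n) \<times> _) set)"
  proof (rule transI)
    fix U V W :: "real^'m^'n"
    assume "(U, V) \<in> co_oriented" "(V, W) \<in> co_oriented"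
    then obtain A B :: "real^'n^'n" where
      "U \<in> ordered_bases" "W \<in> ordered_bases" "det A > 0" "det B > 0" "W = (B ** A) ** U"
      by (auto simp: co_oriented_def matrix_mul_assoc)
    then show "(U, W) \<in> co_oriented"
      by (auto simp: co_oriented_def det_mul intro!: exI[of _ "B ** A"])
  qed
qed

text \<open>The value of \<open>plucker\<close> does not depend on the chosen oriented orthonormal basis.\<close>

lemma plucker_eq_wedge:
  fixes P :: "(real^'m^'n) set"
  assumes P: "P \<in> oriented_grassmannian" and U: "U \<in> P" "orthonormal_tuple U"
  shows "plucker P = wedge U"
proof -
  define V where "V = (SOME U. U \<in> P \<and> orthonormal_tuple U)"
  have V: "V \<in> P" "orthonormal_tuple V"
    unfolding V_def using someI[of "\<lambda>U. U \<in> P \<and> orthonormal_tuple U" U] U by auto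
  have "(U, V) \<in> co_oriented"
    using quotient_eq_iff[OF equiv_co_oriented P[unfolded oriented_grassmannian_def]
        P[unfolded oriented_grassmannian_def] U(1) V(1)] by simp
  then obtain A :: "real^'n^'n" where A: "det A > 0" "V = A ** U"
    by (auto simp: co_oriented_def)
  have unit: "wedge W \<bullet> wedge W = 1" if "orthonormal_tuple W" for W :: "real^'m^'n"
  proof -
    have "(\<chi> i j. W $ i \<bullet> W $ j) = mat 1"
      using that by (simp add: orthonormal_tuple_def mat_def vec_eq_iff)
    then show ?thesis
      by (simp add: inner_wedge)
  qed
  have "wedge V = det A *\<^sub>R wedge U"
    using A(2) by (simp add: wedge_matrix_mult)
  then have "(det A)\<^sup>2 = 1"
    using unit[OF U(2)] unit[OF V(2)] by (simp add: power2_eq_square)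
  then have "det A = 1"
    using A(1) by (simp add: power2_eq_1_iff)
  then show ?thesis
    using \<open>wedge V = _\<close> by (simp add: plucker_def V_def)
qed


section \<open>The normal radius of a cone\<close>

text \<open>
  For an embedded submanifold \<open>M\<close>, this set of velocities is its tangent space at \<open>p\<close>.
\<close>

definition tangent_vectors :: "'a::euclidean_space set \<Rightarrow> 'a \<Rightarrow> 'a set" where
  "tangent_vectors M p = {v. \<exists>\<gamma> \<epsilon>. 0 < \<epsilon> \<and> \<gamma> ` {-\<epsilon><..<\<epsilon>} \<subseteq> M \<and>
     \<gamma> C1_differentiable_on {-\<epsilon><..<\<epsilon>} \<and> \<gamma> 0 = p \<and> (\<gamma> has_vector_derivative v) (at 0)}"

text \<open>
  The ambient Euclidean space is a linear subspace \<open>E\<close> of the type.  The manifold \<open>M \<subseteq> E\<close>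
  lies in a sphere about \<open>0\<close>, whose radius is therefore \<open>norm p\<close> for every \<open>p \<in> M\<close>.
\<close>

definition normal_to_cone_over :: "'a::euclidean_space set \<Rightarrow> 'a set \<Rightarrow> 'a \<Rightarrow> 'a \<Rightarrow> bool" where
  "normal_to_cone_over E M p \<xi> \<longleftrightarrow>
     \<xi> \<in> E \<and> \<xi> \<bullet> p = 0 \<and> (\<forall>v \<in> tangent_vectors M p. \<xi> \<bullet> v = 0)"

definition normal_radius_cone_over :: "'a::euclidean_space set \<Rightarrow> 'a set \<Rightarrow> real" where
  "normal_radius_cone_over E M = (LEAST \<theta>. 0 < \<theta> \<and> \<theta> \<le> pi \<and>
     (\<exists>p \<in> M. \<exists>\<xi>. norm \<xi> = norm p \<and> normal_to_cone_over E M p \<xi> \<and>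
        cos \<theta> *\<^sub>R p + sin \<theta> *\<^sub>R \<xi> \<in> M))"

end

theory Submission
  imports Defs
begin

text \<open>
  The normal radius is in fact equal to \<open>\<pi>/2\<close>.  Write \<open>M\<close> for the image of the Pluecker
  embedding; it consists of the vectors \<open>wedge U\<close> with \<open>U\<close> an orthonormal tuple
  (\<open>plucker_image\<close>).

  No smaller angle is possible.  Suppose that \<open>p = wedge U\<close> and
  \<open>q = wedge V = cos \<theta> p + sin \<theta> \<xi>\<close> lie in \<open>M\<close>, with \<open>\<xi>\<close> normal at \<open>p\<close> and
  \<open>0 < \<theta> < \<pi>/2\<close>.  Rotating one row \<open>U $ i\<close> towards a unit vector \<open>w\<close> orthogonal to the plane
  of \<open>U\<close> gives a curve in \<open>M\<close>, so exchanging that row for \<open>w\<close> gives a tangent vector, which is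
  orthogonal to \<open>q\<close>.  In terms of the Gram matrix \<open>G\<close> of \<open>U\<close> against \<open>V\<close> this says that
  \<open>G\<close> becomes singular when any row is replaced by \<open>(w \<bullet> V $ j)\<^sub>j\<close>.  But
  \<open>det G = p \<bullet> q = cos \<theta>\<close> is nonzero, so by Cramer's rule the replacing row
  vanishes.  Hence every vector orthogonal to the plane of \<open>U\<close> is orthogonal to the plane of
  \<open>V\<close>, the two planes coincide, and \<open>q = \<plusminus> p\<close>, which contradicts \<open>0 < cos \<theta> < 1\<close>.

  The angle \<open>\<pi>/2\<close> occurs.  Exchange two rows of \<open>U\<close> for unit vectors \<open>x\<close>, \<open>y\<close> orthogonal to each
  other and to \<open>U\<close>; this needs \<open>n \<ge> 2\<close> and \<open>m \<ge> n + 2\<close>.  The resulting \<open>\<xi> \<in> M\<close> is normal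
  at \<open>p\<close>: by a Pluecker relation, along any curve in \<open>M\<close> through \<open>p\<close> the coordinate
  along \<open>\<xi>\<close> times the coordinate along \<open>p\<close> is a sum of products of two coordinates vanishing at
  \<open>p\<close>, so the coordinate along \<open>\<xi>\<close> has derivative zero there.
\<close>

section \<open>Exchanging a row\<close>

definition replace_row :: "'n \<Rightarrow> 'a \<Rightarrow> 'a^'n \<Rightarrow> 'a^'n" where
  "replace_row i w U = (\<chi> k. if k = i then w else U $ k)"

lemma replace_row_nth [simp]: "replace_row i w U $ k = (if k = i then w else U $ k)"
  by (simp add: replace_row_def)

lemma replace_row_same [simp]: "replace_row i (U $ i) U = U"
  by (simp add: vec_eq_iff)

lemma replace_row_commute:
  "i \<noteq> k \<Longrightarrow> replace_row i x (replace_row k y U) = replace_row k y (replace_row i x U)"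
  by (simp add: vec_eq_iff)

lemma linear_det_replace_row:
  fixes G :: "real^'n^'n"
  shows "linear (\<lambda>w. det (replace_row i w G))"
proof (rule linearI)
  show "det (replace_row i (x + y) G) = det (replace_row i x G) + det (replace_row i y G)" for x y
    using det_row_add[of i "\<lambda>_. x" "\<lambda>_. y" "\<lambda>k. G $ k"] by (simp add: replace_row_def)
  show "det (replace_row i (c *\<^sub>R x) G) = c *\<^sub>R det (replace_row i x G)" for c x
    using det_row_mul[of i c "\<lambda>_. x" "\<lambda>k. G $ k"]
    by (simp add: replace_row_def scalar_mult_eq_scaleR cong: if_cong)
qed

lemma det_replace_row_eq_0:
  fixes G :: "real^'n^'n"
  assumes "l \<noteq> i"
  shows "det (replace_row i (G $ l) G) = 0"
  using assms by (intro det_identical_rows[of l i]) (auto simp: row_def)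

lemma span_rows_nonsingular:
  fixes G :: "real^'n^'n"
  assumes "det G \<noteq> 0"
  shows "span (range (($) G)) = UNIV"
proof -
  have "rows G = range (($) G)"
    by (auto simp: rows_def row_def)
  moreover have "invertible G"
    using assms invertible_det_nz by blast
  ultimately show ?thesis
    by (metis invertible_def matrix_left_invertible_span_rows)
qed

text \<open>Cramer's rule: up to the factor \<open>det G\<close>, these determinants are the coordinates of \<open>x\<close>
  with respect to the rows of \<open>G\<close>.\<close>

lemma zero_if_replacements_singular:
  fixes G :: "real^'n^'n"
  assumes G: "det G \<noteq> 0" and x: "\<And>i. det (replace_row i x G) = 0"
  shows "x = 0"
proof -
  have "invertible (transpose G)"
    using G invertible_det_nz by (metis det_transpose)
  then obtain c where c: "x = transpose G *v c"
    by (metis invertible_def matrix_vector_mul_assoc matrix_vector_mul_lid)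
  have "x = (\<Sum>l\<in>UNIV. c $ l *s row l G)"
    unfolding c by (simp add: matrix_mult_sum column_transpose)
  then have "replace_row i x G = (\<chi> k. if k = i then \<Sum>l\<in>UNIV. c $ l *s row l G else row k G)" for i
    by (simp add: vec_eq_iff row_def)
  then have "c $ i * det G = det (replace_row i x G)" for i
    using cramer_lemma_transpose[of i c G] by simp
  then have "c = 0"
    using G x by (simp add: vec_eq_iff)
  then show ?thesis
    by (simp add: c)
qed

text \<open>The three-term Pluecker relation.  Both sides are linear in \<open>x\<close>, so it is enough to check
  it on the rows of \<open>G\<close>, which form a basis; there every term is \<open>0\<close> or matches another by
  antisymmetry.\<close>

lemma det_replace_two_rows:
  fixes G :: "real^'n^'n"
  assumes G: "det G \<noteq> 0" and ik: "i \<noteq> k"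
  shows "det G * det (replace_row k y (replace_row i x G)) =
    det (replace_row i x G) * det (replace_row k y G)
    - det (replace_row i y G) * det (replace_row k x G)"
proof -
  define D where "D x = det G * det (replace_row i x (replace_row k y G)) -
    (det (replace_row i x G) * det (replace_row k y G)
    - det (replace_row i y G) * det (replace_row k x G))" for x
  have lin: "linear D"
    unfolding D_def
    by (intro linearI) (simp_all add: linear_add[OF linear_det_replace_row]
        linear_cmul[OF linear_det_replace_row] algebra_simps)
  have "D (G $ l) = 0" for l
  proof -
    consider "l = i" | "l = k" | "l \<noteq> i" "l \<noteq> k" by blast
    then show ?thesis
    proof cases
      case 1
      have "replace_row i (G $ i) (replace_row k y G) = replace_row k y G"
        using ik by (simp add: vec_eq_iff)
      then show ?thesis
        using 1 ik by (simp add: D_def det_replace_row_eq_0)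
    next
      case 2
      let ?A = "replace_row i y G" and ?p = "Transposition.transpose i k"
      have "replace_row i (G $ k) (replace_row k y G) = (\<chi> l. ?A $ ?p l)"
        using ik by (auto simp: vec_eq_iff Transposition.transpose_def)
      moreover have "det (\<chi> l. ?A $ ?p l) = - det ?A"
        using det_permute_rows[of ?p ?A] ik by (simp add: permutes_swap_id sign_swap_id)
      ultimately show ?thesis
        using 2 ik by (simp add: D_def det_replace_row_eq_0)
    next
      case 3
      have "det (replace_row i (G $ l) (replace_row k y G)) = 0"
        using det_replace_row_eq_0[of l i "replace_row k y G"] 3 by simp
      then show ?thesis
        using 3 by (simp add: D_def det_replace_row_eq_0)
    qed
  qed
  then have "D x = 0"
    using linear_eq_0_on_span[OF lin, of "range (($) G)" x] span_rows_nonsingular[OF G] by auto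
  then show ?thesis
    using replace_row_commute[OF ik, of x y G] by (simp add: D_def)
qed


section \<open>Exchanging a vector of a wedge product\<close>

definition gram :: "real^'m^'n \<Rightarrow> real^'m^'n \<Rightarrow> real^'n^'n" where
  "gram U V = (\<chi> i j. U $ i \<bullet> V $ j)"

lemma inner_wedge_gram: "wedge U \<bullet> wedge V = det (gram U V)"
  by (simp add: inner_wedge gram_def)

lemma gram_replace_row: "gram (replace_row i w U) V = replace_row i (\<chi> j. w \<bullet> V $ j) (gram U V)"
  by (simp add: vec_eq_iff gram_def)

lemma linear_wedge_replace_row:
  fixes U :: "real^'m^'n"
  shows "linear (\<lambda>w. wedge (replace_row i w U))"
proof -
  have rows: "(\<chi> k j. replace_row i w U $ k $ I j) = replace_row i (\<chi> j. w $ I j) (\<chi> k j. U $ k $ I j)"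
    for w :: "real^'m" and I :: "'n \<Rightarrow> 'm"
    by (simp add: vec_eq_iff)
  have add: "(\<chi> j. (x + y) $ I j) = (\<chi> j. x $ I j) + (\<chi> j. y $ I j)"
    and scale: "(\<chi> j. (c *\<^sub>R x) $ I j) = c *\<^sub>R (\<chi> j. x $ I j)"
    for x y :: "real^'m" and I :: "'n \<Rightarrow> 'm" and c
    by (simp_all add: vec_eq_iff)
  show ?thesis
  proof (rule linearI)
    show "wedge (replace_row i (x + y) U) = wedge (replace_row i x U) + wedge (replace_row i y U)"
      for x y
      unfolding wedge_def rows add linear_add[OF linear_det_replace_row]
      by (simp add: vec_eq_iff add_divide_distrib)
    show "wedge (replace_row i (c *\<^sub>R x) U) = c *\<^sub>R wedge (replace_row i x U)" for c x
      unfolding wedge_def rows scale linear_cmul[OF linear_det_replace_row]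
      by (simp add: vec_eq_iff)
  qed
qed

lemma inner_wedge_replace_row_eq_0:
  assumes "\<And>k. w \<bullet> V $ k = 0"
  shows "wedge (replace_row i w U) \<bullet> wedge V = 0"
proof -
  have "(\<chi> j. w \<bullet> V $ j) = 0"
    using assms by (simp add: vec_eq_iff)
  then show ?thesis
    using linear_0[OF linear_det_replace_row] by (simp add: inner_wedge_gram gram_replace_row)
qed

lemma plucker_relation:
  assumes "wedge U \<bullet> wedge W \<noteq> 0" and "i \<noteq> k"
  shows "(wedge U \<bullet> wedge W) * (wedge (replace_row k y (replace_row i x U)) \<bullet> wedge W) =
    (wedge (replace_row i x U) \<bullet> wedge W) * (wedge (replace_row k y U) \<bullet> wedge W)
    - (wedge (replace_row i y U) \<bullet> wedge W) * (wedge (replace_row k x U) \<bullet> wedge W)"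
  using det_replace_two_rows[of "gram U W" i k] assms
  by (simp add: inner_wedge_gram gram_replace_row)


section \<open>The image of the Pluecker embedding\<close>

lemma orthonormal_tuple_replace_row:
  assumes "orthonormal_tuple U" and "\<And>k. w \<bullet> U $ k = 0" and "norm w = 1"
  shows "orthonormal_tuple (replace_row i w U)"
  using assms by (auto simp: orthonormal_tuple_def inner_commute norm_eq_1)

lemma norm_wedge_orthonormal:
  assumes "orthonormal_tuple U"
  shows "norm (wedge U) = 1"
proof -
  have "gram U U = mat 1"
    using assms by (simp add: orthonormal_tuple_def gram_def mat_def vec_eq_iff)
  then show ?thesis
    by (simp add: norm_eq_1 inner_wedge_gram)
qed

lemma orthonormal_tuple_ordered_bases:
  assumes U: "orthonormal_tuple U"
  shows "U \<in> ordered_bases"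
proof -
  have inner: "U $ i \<bullet> U $ j = (if i = j then 1 else 0)" for i j
    using U by (simp add: orthonormal_tuple_def)
  have "inj (\<lambda>i. U $ i)"
    by (rule injI) (metis inner zero_neq_one)
  moreover have "independent (range (\<lambda>i. U $ i))"
  proof (rule pairwise_orthogonal_independent)
    show "pairwise orthogonal (range (\<lambda>i. U $ i))"
      by (auto simp: pairwise_def orthogonal_def inner)
    show "0 \<notin> range (\<lambda>i. U $ i)"
      by (metis imageE inner inner_zero_left zero_neq_one)
  qed
  ultimately show ?thesis
    by (simp add: ordered_bases_def)
qed

text \<open>An orthonormal basis of the span of \<open>B\<close> exists; if it has the wrong orientation, negating
  one of its vectors corrects this.\<close>

lemma co_oriented_orthonormal:
  fixes B :: "real^'m^'n"
  assumes B: "B \<in> ordered_bases"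
  obtains U where "(B, U) \<in> co_oriented" and "orthonormal_tuple U"
proof -
  let ?S = "span (range (\<lambda>i. B $ i))"
  have injB: "inj (\<lambda>i. B $ i)" and indB: "independent (range (\<lambda>i. B $ i))"
    using B by (auto simp: ordered_bases_def)
  obtain N where N: "pairwise orthogonal N" "\<And>x. x \<in> N \<Longrightarrow> norm x = 1"
      "card N = dim ?S" "span N = ?S" "independent N"
    using orthonormal_basis_subspace[of ?S] by (metis subspace_span)
  have "card N = CARD('n)"
    using N(3) indB injB by (simp add: dim_eq_card_independent card_image)
  then obtain f :: "'n \<Rightarrow> real^'m" where f: "bij_betw f UNIV N"
    using N(5) by (metis finite_class.finite_UNIV finite_same_card_bij independent_imp_finite)
  define U where "U = (\<chi> i. f i)"
  have U: "orthonormal_tuple U"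
    unfolding orthonormal_tuple_def
  proof (intro allI)
    fix i j
    have "f i \<in> N" "f j \<in> N" "i \<noteq> j \<Longrightarrow> f i \<noteq> f j"
      using f by (auto simp: bij_betw_def inj_eq)
    then show "U $ i \<bullet> U $ j = (if i = j then 1 else 0)"
      using N(1,2) by (auto simp: U_def pairwise_def orthogonal_def dot_square_norm)
  qed
  have injU: "inj (\<lambda>i. U $ i)"
    using f by (simp add: U_def bij_betw_def)
  have span_eq: "range (\<lambda>i. U $ i) = N"
    using f by (simp add: U_def bij_betw_def)
  have change: "\<exists>A :: real^'n^'n. Y = A ** X"
    if X: "inj (\<lambda>i. X $ i)" and Y: "\<And>i. Y $ i \<in> span (range (\<lambda>i. X $ i))" for X Y :: "real^'m^'n"
  proof -
    have "\<exists>c :: real^'n. Y $ i = (\<Sum>j\<in>UNIV. c $ j *\<^sub>R X $ j)" for i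
    proof -
      obtain u where "Y $ i = (\<Sum>v\<in>range (\<lambda>i. X $ i). u v *\<^sub>R v)"
        using Y[of i] by (auto simp: span_finite)
      then have "Y $ i = (\<Sum>j\<in>UNIV. (\<chi> j. u (X $ j)) $ j *\<^sub>R X $ j)"
        using X by (simp add: sum.reindex)
      then show ?thesis ..
    qed
    then obtain c :: "'n \<Rightarrow> real^'n" where c: "\<And>i. Y $ i = (\<Sum>j\<in>UNIV. c i $ j *\<^sub>R X $ j)"
      by metis
    then have "Y = (\<chi> i. c i) ** X"
      by (simp add: vec_eq_iff matrix_matrix_mult_def)
    then show ?thesis ..
  qed
  have "B $ i \<in> span (range (\<lambda>i. U $ i))" for i
    using N(4) span_base[of "B $ i" "range (\<lambda>i. B $ i)"] by (simp add: span_eq)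
  then obtain C where C: "B = C ** U"
    using change[of U B] injU by blast
  have "U $ i \<in> ?S" for i
    using N(4) span_base[of "U $ i" N] span_eq by auto
  then obtain A where A: "U = A ** B"
    using change[of B U] injB by blast
  \<comment> \<open>\<open>A\<close> is invertible with inverse \<open>C\<close>, as \<open>B\<close> and \<open>U\<close> are expressed in terms of each other; its
    determinant can be read off from the wedge products.\<close>
  have "wedge U = (det A * det C) *\<^sub>R wedge U"
    by (metis A C scaleR_scaleR wedge_matrix_mult)
  moreover have "wedge U \<noteq> 0"
    using norm_wedge_orthonormal[OF U] by force
  ultimately have "det A \<noteq> 0"
    by auto
  then consider "det A > 0" | "det A < 0"
    by linarith
  then show thesis
  proof cases
    case 1
    then have "(B, U) \<in> co_oriented"
      using A B orthonormal_tuple_ordered_bases[OF U] by (auto simp: co_oriented_def)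
    then show thesis
      using U that by blast
  next
    case 2
    \<comment> \<open>any index will do\<close>
    define k :: 'n where "k = undefined"
    define V where "V = replace_row k (- (U $ k)) U"
    have V: "orthonormal_tuple V"
      using U by (auto simp: V_def orthonormal_tuple_def)
    have "V = replace_row k (- (A $ k)) A ** B"
      by (simp add: V_def vec_eq_iff A matrix_matrix_mult_def sum_negf)
    moreover have "det (replace_row k (- (A $ k)) A) = - det A"
      using linear_neg[OF linear_det_replace_row, of k "A $ k" A] by simp
    ultimately have "\<exists>A' :: real^'n^'n. det A' > 0 \<and> V = A' ** B"
      using 2 by (metis neg_0_less_iff_less)
    then have "(B, V) \<in> co_oriented"
      using B orthonormal_tuple_ordered_bases[OF V] by (simp add: co_oriented_def)
    then show thesis
      using V that by blast
  qed
qed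

lemma plucker_image:
  "plucker ` (oriented_grassmannian :: (real^'m^'n) set set) = wedge ` {U. orthonormal_tuple U}"
proof (intro equalityI subsetI)
  fix q assume "q \<in> plucker ` (oriented_grassmannian :: (real^'m^'n) set set)"
  then obtain P :: "(real^'m^'n) set" where P: "P \<in> oriented_grassmannian" and q: "q = plucker P"
    by blast
  then obtain B where "B \<in> ordered_bases" and B: "P = co_oriented `` {B}"
    by (auto simp: oriented_grassmannian_def elim: quotientE)
  then obtain U where "(B, U) \<in> co_oriented" "orthonormal_tuple U"
    using co_oriented_orthonormal by blast
  then show "q \<in> wedge ` {U. orthonormal_tuple U}"
    using plucker_eq_wedge[OF P, of U] B q by auto
next
  fix q :: "real^('n \<Rightarrow> 'm)" assume "q \<in> wedge ` {U. orthonormal_tuple U}"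
  then obtain U :: "real^'m^'n" where U: "orthonormal_tuple U" and q: "q = wedge U"
    by blast
  let ?P = "co_oriented `` {U}"
  have "?P \<in> oriented_grassmannian" "U \<in> ?P"
    using orthonormal_tuple_ordered_bases[OF U] equiv_class_self[OF equiv_co_oriented]
    by (auto simp: oriented_grassmannian_def intro: quotientI)
  then show "q \<in> plucker ` oriented_grassmannian"
    using plucker_eq_wedge[of ?P U] U q by (metis image_eqI)
qed


section \<open>Tangent and normal vectors\<close>

text \<open>The curve rotates the vector \<open>U $ i\<close> towards \<open>w\<close>.\<close>

lemma wedge_replace_row_tangent:
  fixes U :: "real^'m^'n"
  assumes U: "orthonormal_tuple U" and w: "\<And>k. w \<bullet> U $ k = 0" "norm w = 1"
  shows "wedge (replace_row i w U) \<in> tangent_vectors (wedge ` {U. orthonormal_tuple U}) (wedge U)"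
proof -
  let ?a = "wedge U" and ?b = "wedge (replace_row i w U)"
  define \<gamma> where "\<gamma> t = wedge (replace_row i (cos t *\<^sub>R U $ i + sin t *\<^sub>R w) U)" for t
  have \<gamma>: "\<gamma> = (\<lambda>t. cos t *\<^sub>R ?a + sin t *\<^sub>R ?b)"
    by (simp add: fun_eq_iff \<gamma>_def linear_add[OF linear_wedge_replace_row]
        linear_cmul[OF linear_wedge_replace_row])
  have "orthonormal_tuple (replace_row i (cos t *\<^sub>R U $ i + sin t *\<^sub>R w) U)" for t
    using U w by (auto simp: orthonormal_tuple_def inner_add_left inner_add_right inner_commute
        norm_eq_1 simp flip: power2_eq_square)
  then have "\<gamma> ` {-1<..<1} \<subseteq> wedge ` {U. orthonormal_tuple U}"
    by (auto simp: \<gamma>_def)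
  moreover have deriv: "(\<gamma> has_vector_derivative (- sin t *\<^sub>R ?a + cos t *\<^sub>R ?b)) (at t)" for t
    unfolding \<gamma> by (auto intro!: derivative_eq_intros simp: has_real_derivative_iff_has_vector_derivative[symmetric])
  moreover have "\<gamma> C1_differentiable_on {-1<..<1}"
    unfolding C1_differentiable_on_def
    by (intro exI[of _ "\<lambda>t. - sin t *\<^sub>R ?a + cos t *\<^sub>R ?b"] conjI ballI deriv)
      (intro continuous_intros)
  moreover have "\<gamma> 0 = ?a"
    by (simp add: \<gamma>)
  ultimately show ?thesis
    unfolding tangent_vectors_def using deriv[of 0] by (auto intro!: exI[of _ \<gamma>] exI[of _ 1])
qed

text \<open>Moving two vectors of \<open>U\<close> at once is a second-order effect: by the Pluecker relation, the
  coordinate of a curve through \<open>wedge U\<close> along a double exchange is quadratic in its coordinates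
  along single exchanges, which vanish at \<open>wedge U\<close>.\<close>

lemma wedge_replace_two_rows_normal:
  fixes U :: "real^'m^'n"
  assumes U: "orthonormal_tuple U" and x: "\<And>k. x \<bullet> U $ k = 0" and y: "\<And>k. y \<bullet> U $ k = 0"
    and ik: "i \<noteq> k"
  shows "normal_to_cone_over exterior_power (wedge ` {U. orthonormal_tuple U}) (wedge U)
    (wedge (replace_row k y (replace_row i x U)))" (is "normal_to_cone_over _ ?M ?p ?\<xi>")
  unfolding normal_to_cone_over_def
proof (intro conjI ballI)
  show "?\<xi> \<in> exterior_power"
    by (simp add: exterior_power_def span_base)
  show \<xi>p: "?\<xi> \<bullet> ?p = 0"
    by (rule inner_wedge_replace_row_eq_0) (rule y)
  fix v assume "v \<in> tangent_vectors ?M ?p"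
  then obtain \<gamma> \<epsilon> where \<epsilon>: "\<epsilon> > 0" and \<gamma>M: "\<gamma> ` {-\<epsilon><..<\<epsilon>} \<subseteq> ?M"
    and \<gamma>0: "\<gamma> 0 = ?p" and \<gamma>: "(\<gamma> has_vector_derivative v) (at 0)"
    by (auto simp: tangent_vectors_def)
  have deriv: "((\<lambda>t. a \<bullet> \<gamma> t) has_real_derivative a \<bullet> v) (at 0)" for a
    unfolding has_real_derivative_iff_has_vector_derivative
    by (rule bounded_linear.has_vector_derivative[OF bounded_linear_inner_right \<gamma>])
  have pp: "?p \<bullet> ?p = 1"
    using norm_wedge_orthonormal[OF U] by (simp add: norm_eq_1)
  have vanish: "wedge (replace_row j z U) \<bullet> \<gamma> 0 = 0" if "z \<in> {x, y}" for j z
    unfolding \<gamma>0 by (rule inner_wedge_replace_row_eq_0) (use that x y in auto)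
  let ?f = "\<lambda>t. (?p \<bullet> \<gamma> t) * (?\<xi> \<bullet> \<gamma> t)"
  let ?g = "\<lambda>t. (wedge (replace_row i x U) \<bullet> \<gamma> t) * (wedge (replace_row k y U) \<bullet> \<gamma> t)
    - (wedge (replace_row i y U) \<bullet> \<gamma> t) * (wedge (replace_row k x U) \<bullet> \<gamma> t)"
  have f: "(?f has_real_derivative ?\<xi> \<bullet> v) (at 0)"
    by (rule DERIV_cong[OF DERIV_mult[OF deriv deriv]]) (use \<gamma>0 pp \<xi>p in simp)
  have g: "(?g has_real_derivative 0) (at 0)"
    by (rule DERIV_cong[OF DERIV_diff[OF DERIV_mult[OF deriv deriv] DERIV_mult[OF deriv deriv]]])
      (simp add: vanish)
  have "eventually (\<lambda>t. ?p \<bullet> \<gamma> t \<noteq> 0) (nhds 0)"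
  proof -
    have "isCont (\<lambda>t. ?p \<bullet> \<gamma> t) 0"
      using deriv DERIV_isCont by blast
    moreover have "?p \<bullet> \<gamma> 0 \<noteq> 0"
      using \<gamma>0 pp by simp
    ultimately have "eventually (\<lambda>t. ?p \<bullet> \<gamma> t \<noteq> 0) (at 0)"
      by (simp add: isCont_def tendsto_imp_eventually_ne)
    then show ?thesis
      using \<open>?p \<bullet> \<gamma> 0 \<noteq> 0\<close> by (simp add: eventually_nhds_conv_at)
  qed
  moreover have "eventually (\<lambda>t. t \<in> {-\<epsilon><..<\<epsilon>}) (nhds 0)"
    using \<epsilon> by (intro eventually_nhds_in_open) auto
  ultimately have "eventually (\<lambda>t. ?f t = ?g t) (nhds 0)"
  proof eventually_elim
    case (elim t)
    then obtain W where "\<gamma> t = wedge W"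
      using \<gamma>M by blast
    then show ?case
      using plucker_relation[of U W i k y x] elim ik by simp
  qed
  then have "(?f has_real_derivative 0) (at 0)"
    using g by (subst DERIV_cong_ev[OF refl _ refl])
  then show "?\<xi> \<bullet> v = 0"
    using f DERIV_unique by blast
qed


section \<open>The smallest angle\<close>

text \<open>By Cramer's rule a vector \<open>w\<close> orthogonal to \<open>U\<close> is orthogonal to \<open>V\<close> as well, which is
  applied to the components of the vectors of \<open>V\<close> orthogonal to the plane of \<open>U\<close>.\<close>

lemma wedge_eq_if_orthogonal_to_exchanges:
  fixes U V :: "real^'m^'n"
  assumes U: "orthonormal_tuple U" and UV: "wedge U \<bullet> wedge V \<noteq> 0"
    and ex: "\<And>i w. \<lbrakk>\<And>k. w \<bullet> U $ k = 0; norm w = 1\<rbrakk> \<Longrightarrow> wedge (replace_row i w U) \<bullet> wedge V = 0"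
  shows "wedge V = (wedge U \<bullet> wedge V) *\<^sub>R wedge U"
proof -
  have orth: "w \<bullet> V $ j = 0" if w: "\<And>k. w \<bullet> U $ k = 0" for w j
  proof (cases "w = 0")
    case False
    have "(\<chi> j. sgn w \<bullet> V $ j) = 0"
    proof (rule zero_if_replacements_singular)
      show "det (gram U V) \<noteq> 0"
        using UV by (simp add: inner_wedge_gram)
      fix i
      have "wedge (replace_row i (sgn w) U) \<bullet> wedge V = 0"
        using False w by (intro ex) (auto simp: sgn_div_norm norm_sgn)
      then show "det (replace_row i (\<chi> j. sgn w \<bullet> V $ j) (gram U V)) = 0"
        by (simp add: inner_wedge_gram gram_replace_row)
    qed
    then have "sgn w \<bullet> V $ j = 0"
      by (simp add: vec_eq_iff)
    then show ?thesis
      using False by (auto simp: sgn_div_norm)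
  qed simp
  have "V $ j = (\<Sum>i\<in>UNIV. (V $ j \<bullet> U $ i) *\<^sub>R U $ i)" for j
  proof -
    define w where "w = V $ j - (\<Sum>i\<in>UNIV. (V $ j \<bullet> U $ i) *\<^sub>R U $ i)"
    have inner: "U $ i \<bullet> U $ k = (if i = k then 1 else 0)" for i k
      using U by (simp add: orthonormal_tuple_def)
    have w: "w \<bullet> U $ k = 0" for k
      by (simp add: w_def inner_diff_left inner_sum_left inner if_distrib cong: if_cong)
    have "w \<bullet> w = w \<bullet> V $ j - (\<Sum>i\<in>UNIV. (V $ j \<bullet> U $ i) * (w \<bullet> U $ i))"
      by (subst (2) w_def) (simp add: inner_diff_right inner_sum_right)
    then have "w = 0"
      using w orth[of w j] by simp
    then show ?thesis
      by (simp add: w_def)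
  qed
  then have "V = transpose (gram U V) ** U"
    by (simp add: vec_eq_iff matrix_matrix_mult_def transpose_def gram_def inner_commute)
  then show ?thesis
    by (metis det_transpose inner_wedge_gram wedge_matrix_mult)
qed

lemma normal_angle_ge_pi_half:
  fixes U V :: "real^'m^'n"
  assumes U: "orthonormal_tuple U" and V: "orthonormal_tuple V"
    and \<xi>: "normal_to_cone_over E (wedge ` {U. orthonormal_tuple U}) (wedge U) \<xi>"
    and q: "wedge V = cos \<theta> *\<^sub>R wedge U + sin \<theta> *\<^sub>R \<xi>" and "0 < \<theta>"
  shows "pi / 2 \<le> \<theta>"
proof (rule ccontr)
  assume "\<not> pi / 2 \<le> \<theta>"
  then have cos: "0 < cos \<theta>" "cos \<theta> < 1"
    using \<open>0 < \<theta>\<close> cos_gt_zero[of \<theta>] cos_monotone_0_pi[of 0 \<theta>] by auto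
  have UU: "wedge U \<bullet> wedge U = 1"
    using norm_wedge_orthonormal[OF U] by (simp add: norm_eq_1)
  have UV: "wedge U \<bullet> wedge V = cos \<theta>"
    using \<xi> by (simp add: q inner_add_right UU normal_to_cone_over_def inner_commute)
  have "wedge V = (wedge U \<bullet> wedge V) *\<^sub>R wedge U"
  proof (rule wedge_eq_if_orthogonal_to_exchanges[OF U])
    show "wedge U \<bullet> wedge V \<noteq> 0"
      using UV cos by simp
    fix i w assume w: "\<And>k. w \<bullet> U $ k = 0" "norm w = 1"
    have "wedge (replace_row i w U) \<bullet> \<xi> = 0"
      using wedge_replace_row_tangent[OF U w] \<xi> unfolding normal_to_cone_over_def
      by (metis inner_commute)
    then show "wedge (replace_row i w U) \<bullet> wedge V = 0"
      using inner_wedge_replace_row_eq_0[of w U] w(1) by (simp add: q inner_add_right)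
  qed
  then have "norm (wedge V) = cos \<theta>"
    using UV cos norm_wedge_orthonormal[OF U] by simp
  then show False
    using norm_wedge_orthonormal[OF V] cos by simp
qed

lemma orthonormal_tuple_with_two_normals:
  assumes "CARD('n::finite) + 2 \<le> CARD('m::finite)"
  obtains U :: "real^'m^'n" and x y where "orthonormal_tuple U" "\<And>k. x \<bullet> U $ k = 0"
    "\<And>k. y \<bullet> U $ k = 0" "norm x = 1" "norm y = 1" "x \<bullet> y = 0"
proof -
  obtain f :: "'n \<Rightarrow> 'm" where f: "inj f"
    using assms card_le_inj[of "UNIV :: 'n set" "UNIV :: 'm set"] by auto
  have "card (- range f) = CARD('m) - CARD('n)"
    using f by (simp add: Compl_eq_Diff_UNIV card_Diff_subset card_image)
  then have "2 \<le> card (- range f)"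
    using assms by simp
  then obtain T where T: "T \<subseteq> - range f" "card T = 2"
    by (metis ex_card)
  obtain a b where "T = {a, b}" and "a \<noteq> b"
    using T(2) by (auto simp: card_2_iff)
  then have ab: "a \<notin> range f" "b \<notin> range f" "a \<noteq> b"
    using T(1) by auto
  define U :: "real^'m^'n" where "U = (\<chi> i. axis (f i) 1)"
  have U: "orthonormal_tuple U"
    using f by (simp add: orthonormal_tuple_def U_def inner_axis_axis inj_eq)
  have orth: "axis c 1 \<bullet> U $ k = 0" if "c \<notin> range f" for c k
  proof -
    have "c \<noteq> f k"
      using that by blast
    then show ?thesis
      by (simp add: U_def inner_axis_axis)
  qed
  have "axis a 1 \<bullet> (axis b 1 :: real^'m) = 0"
    using ab by (simp add: inner_axis_axis)
  then show thesis
    using that[of U "axis a 1" "axis b 1"] U orth ab by simp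
qed

theorem theorem6p2:
  fixes n m :: nat
  assumes "CARD('n::finite) = n" and "CARD('m::finite) = m"
    and "2 \<le> n" and "n + 2 \<le> m"
  shows "normal_radius_cone_over exterior_power
           (plucker ` (oriented_grassmannian :: (real^'m^'n) set set)) \<ge> pi / 2"
proof -
  let ?M = "wedge ` {U :: real^'m^'n. orthonormal_tuple U}"
  obtain U :: "real^'m^'n" and x y where U: "orthonormal_tuple U"
    and x: "\<And>k. x \<bullet> U $ k = 0" "norm x = 1" and y: "\<And>k. y \<bullet> U $ k = 0" "norm y = 1"
    and xy: "x \<bullet> y = 0"
    using orthonormal_tuple_with_two_normals assms by metis
  obtain i k :: 'n where ik: "i \<noteq> k"
    using assms by (metis card_2_iff' ex_card)
  let ?V = "replace_row k y (replace_row i x U)"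
  have V: "orthonormal_tuple ?V"
    using U x y xy by (intro orthonormal_tuple_replace_row) (auto simp: inner_commute)
  have attained: "\<exists>p \<in> ?M. \<exists>\<xi>. norm \<xi> = norm p \<and> normal_to_cone_over exterior_power ?M p \<xi> \<and>
      cos (pi / 2) *\<^sub>R p + sin (pi / 2) *\<^sub>R \<xi> \<in> ?M"
  proof (intro bexI exI conjI)
    show "norm (wedge ?V) = norm (wedge U)"
      using U V by (simp add: norm_wedge_orthonormal)
    show "normal_to_cone_over exterior_power ?M (wedge U) (wedge ?V)"
      by (rule wedge_replace_two_rows_normal[OF U x(1) y(1) ik])
    show "cos (pi / 2) *\<^sub>R wedge U + sin (pi / 2) *\<^sub>R wedge ?V \<in> ?M"
      using V by simp
    show "wedge U \<in> ?M"
      using U by simp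
  qed
  have "normal_radius_cone_over exterior_power ?M = pi / 2"
    unfolding normal_radius_cone_over_def
  proof (rule Least_equality)
    show "0 < pi / 2 \<and> pi / 2 \<le> pi \<and> (\<exists>p \<in> ?M. \<exists>\<xi>. norm \<xi> = norm p \<and>
        normal_to_cone_over exterior_power ?M p \<xi> \<and> cos (pi / 2) *\<^sub>R p + sin (pi / 2) *\<^sub>R \<xi> \<in> ?M)"
      using attained by simp
  next
    fix \<theta> assume "0 < \<theta> \<and> \<theta> \<le> pi \<and> (\<exists>p \<in> ?M. \<exists>\<xi>. norm \<xi> = norm p \<and>
        normal_to_cone_over exterior_power ?M p \<xi> \<and> cos \<theta> *\<^sub>R p + sin \<theta> *\<^sub>R \<xi> \<in> ?M)"
    then obtain W V :: "real^'m^'n" and \<xi> where "orthonormal_tuple W" "orthonormal_tuple V"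
      "normal_to_cone_over exterior_power ?M (wedge W) \<xi>"
      "wedge V = cos \<theta> *\<^sub>R wedge W + sin \<theta> *\<^sub>R \<xi>" "0 < \<theta>"
      by (auto simp: image_iff)
    then show "pi / 2 \<le> \<theta>"
      by (rule normal_angle_ge_pi_half)
  qed
  then show ?thesis
    by (simp add: plucker_image)
qed

end
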